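(* Assume that $\mathbf{K}\subseteq\mathbb{R}^n$ is compact and satisfies the following condition: for all points $a\in\mathbf{K}$ there exist constants $\eta_{\mathbf{K}}>0$ and $\epsilon_{\mathbf{K}}>0$ such that $$\mathrm{vol}(B_\epsilon(a)\cap\mathbf{K})\ \ge\ \eta_{\mathbf{K}}\,\mathrm{vol}\,B_\epsilon(a)\quad\text{for all }0<\epsilon\le\epsilon_{\mathbf{K}}.$$ Then there exists a constant $\zeta(\mathbf{K})$ (depending only on $\mathbf{K}$) such that, for all Lipschitz continuous functions $f$ with Lipschitz constant $M_f$ on $\mathbf{K}$, the following inequality holds: $$\underline{f}^{(r)}_{\mathbf{K}}-f_{\min,\mathbf{K}}\ \le\ \frac{\zeta(\mathbf{K})\,M_f}{\sqrt{r}}\quad\text{for all } r\ge r_{\mathbf{K}}+1.$$ Moreover, if $f$ is a polynomial of degree $d$ and $\mathbf{K}$ is a convex body, then $$\underline{f}^{(r)}_{\mathbf{K}}-f_{\min,\mathbf{K}}\ \le\ \frac{2d^2\,\zeta(\mathbf{K})\,\sup_{x\in\mathbf{K}}|f(x)|}{w_{\min}(\mathbf{K})}\,\frac{1}{\sqrt{r}}\quad\text{for all } r\ge r_{\mathbf{K}}+1.$$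
   Context: $\|\cdot\|$ is the Euclidean norm on $\mathbb{R}^n$, $B_\epsilon(a)=\{x\in\mathbb{R}^n:\|x-a\|\le\epsilon\}$, and $\mathrm{vol}$ is Lebesgue measure. The functions $f:\mathbb{R}^n\to\mathbb{R}$ considered are continuous, and $f_{\min,\mathbf{K}}=\min_{x\in\mathbf{K}}f(x)$. For $r\in\mathbb{N}$, $\Sigma[x]_r$ denotes the set of polynomials in $\mathbb{R}[x_1,\dots,x_n]$ of degree at most $2r$ that are sums of squares of real polynomials, and $$\underline{f}^{(r)}_{\mathbf{K}}:=\inf\Big\{\int_{\mathbf{K}}h(x)f(x)\,dx\ :\ h\in\Sigma[x]_r,\ \int_{\mathbf{K}}h(x)\,dx=1\Big\}.$$ $f$ is Lipschitz continuous on $\mathbf{K}$ with Lipschitz constant $M_f$ if $|f(y)-f(x)|\le M_f\|y-x\|$ for all $x,y\in\mathbf{K}$. $D(\mathbf{K})=\max_{x,y\in\mathbf{K}}\|x-y\|^2$ is the squared diameter. $w_{\min}(\mathbf{K})$ is the minimal width of $\mathbf{K}$, i.e. the minimum distance between two distinct parallel supporting hyperplanes of $\mathbf{K}$. A convex body is a full-dimensional compact convex set. With $e$ the base of the natural logarithm, $$r_{\mathbf{K}}:=\max\Big\{\frac{D(\mathbf{K})e}{2\epsilon_{\mathbf{K}}^3},\,n\Big\}\ \text{ if }\epsilon_{\mathbf{K}}\le1,\qquad r_{\mathbf{K}}:=\frac{D(\mathbf{K})e}{2}\ \text{ if }\epsilon_{\mathbf{K}}>1.$$ The parameters $\eta_{\mathbf{K}}$,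 $\epsilon_{\mathbf{K}}$ and $r_{\mathbf{K}}$ depend not only on $\mathbf{K}$ but also on the point $a\in\mathbf{K}$; this dependence is omitted from the notation, and they are taken at a point $a$ that is a global minimizer of $f$ over $\mathbf{K}$.
   Formalization: ζ may depend on the density constant η_K (at the minimizer a) as well as on K; one ζ(K) for all a fails, e.g. for [-1,0] with rapidly shrinking intervals around 2^-k. If η_K and ε_K can be chosen uniformly in a, as for convex bodies, a single ζ(K) results. *)

theory Defs
  imports "HOL-Analysis.Analysis"
begin

definition monomial_fun :: "('n::finite \<Rightarrow> nat) \<Rightarrow> real ^ 'n \<Rightarrow> real" where
  "monomial_fun \<alpha> x = (\<Prod>i\<in>UNIV. (x $ i) ^ \<alpha> i)"

text \<open>Real polynomials in \<open>n = CARD('n)\<close> variables are represented by the functions they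
  induce, which is faithful because the reals are infinite.  The zero polynomial gets degree 0.\<close>

definition polys_deg_le :: "nat \<Rightarrow> (real ^ 'n::finite \<Rightarrow> real) set" where
  "polys_deg_le d =
     {p. \<exists>c. p = (\<lambda>x. \<Sum>\<alpha> | (\<Sum>i\<in>UNIV. \<alpha> i) \<le> d. c \<alpha> * monomial_fun \<alpha> x)}"

definition polynomial_of_degree :: "nat \<Rightarrow> (real ^ 'n::finite \<Rightarrow> real) \<Rightarrow> bool" where
  "polynomial_of_degree d f \<longleftrightarrow> f \<in> polys_deg_le d \<and> (\<forall>k<d. f \<notin> polys_deg_le k)"

definition sos_polys :: "nat \<Rightarrow> (real ^ 'n::finite \<Rightarrow> real) set" where
  "sos_polys r =
     {h \<in> polys_deg_le (2 * r).
        \<exists>m (q :: nat \<Rightarrow> real ^ 'n \<Rightarrow> real).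
          (\<forall>j<m. real_polynomial_function (q j)) \<and> h = (\<lambda>x. \<Sum>j<m. (q j x)\<^sup>2)}"

definition lasserre_upper ::
    "(real ^ 'n::finite) set \<Rightarrow> (real ^ 'n \<Rightarrow> real) \<Rightarrow> nat \<Rightarrow> real" where
  "lasserre_upper K f r =
     Inf {(LINT x:K|lebesgue. h x * f x) | h.
            h \<in> sos_polys r \<and> (LINT x:K|lebesgue. h x) = 1}"

text \<open>The constants of the density condition may vary with the point \<open>a\<close>, so they are explicit
  arguments here and in the threshold \<open>r_bound\<close>.\<close>

definition density_cond ::
    "(real ^ 'n::finite) set \<Rightarrow> real ^ 'n \<Rightarrow> real \<Rightarrow> real \<Rightarrow> bool" where
  "density_cond K a \<eta> \<epsilon>K \<longleftrightarrow> \<eta> > 0 \<and> \<epsilon>K > 0 \<and>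
     (\<forall>\<epsilon>. 0 < \<epsilon> \<and> \<epsilon> \<le> \<epsilon>K \<longrightarrow>
        measure lebesgue (cball a \<epsilon> \<inter> K) \<ge> \<eta> * measure lebesgue (cball a \<epsilon>))"

definition sq_diameter :: "(real ^ 'n::finite) set \<Rightarrow> real" where
  "sq_diameter K = (diameter K)\<^sup>2"

definition r_bound :: "(real ^ 'n::finite) set \<Rightarrow> real \<Rightarrow> real" where
  "r_bound K \<epsilon>K =
     (if \<epsilon>K \<le> 1 then max (sq_diameter K * exp 1 / (2 * \<epsilon>K ^ 3)) (real CARD('n))
      else sq_diameter K * exp 1 / 2)"

definition supports_at :: "(real ^ 'n::finite) set \<Rightarrow> real ^ 'n \<Rightarrow> real \<Rightarrow> bool" where
  "supports_at K u b \<longleftrightarrow> u \<noteq> 0 \<and> (\<exists>x\<in>K. u \<bullet> x = b) \<and>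
     (K \<subseteq> {x. u \<bullet> x \<le> b} \<or> K \<subseteq> {x. u \<bullet> x \<ge> b})"

text \<open>Parallel hyperplanes are written with a common normal vector \<open>u\<close>, so they are distinct
  iff their offsets differ.\<close>

definition min_width :: "(real ^ 'n::finite) set \<Rightarrow> real" where
  "min_width K =
     Inf {setdist {x. u \<bullet> x = b} {x. u \<bullet> x = c} | u b c.
            supports_at K u b \<and> supports_at K u c \<and> b \<noteq> c}"

definition convex_body :: "(real ^ 'n::finite) set \<Rightarrow> bool" where
  "convex_body K \<longleftrightarrow> compact K \<and> convex K \<and> aff_dim K = int CARD('n)"

definition is_global_minimizer ::
    "(real ^ 'n::finite) set \<Rightarrow> (real ^ 'n \<Rightarrow> real) \<Rightarrow> real ^ 'n \<Rightarrow> bool" where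
  "is_global_minimizer K f a \<longleftrightarrow> a \<in> K \<and> (\<forall>x\<in>K. f a \<le> f x)"

end

theory Submission
  imports Defs "HOL-Complex_Analysis.Conformal_Mappings"
begin

text \<open>
  Let \<open>a\<close> minimise \<open>f\<close> over \<open>K\<close>, let \<open>\<delta>\<close> be the diameter of \<open>K\<close> and \<open>n\<close> the dimension.  If \<open>h\<close> is an
  admissible sum of squares, that is, a probability density on \<open>K\<close>, and \<open>f\<close> has Lipschitz constant \<open>M\<close>
  on \<open>K\<close>, then the integral of \<open>h * f\<close> exceeds \<open>f a\<close> by at most \<open>M\<close> times the first moment of \<open>h\<close> about
  \<open>a\<close> (\<open>lasserre_upper_le_first_moment\<close>).  So it suffices to exhibit one \<open>h\<close> of degree at most \<open>2 * r\<close>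
  whose mass lies at mean distance \<open>O (1 / sqrt r)\<close> from \<open>a\<close>.

  Such an \<open>h\<close> is the normalisation of \<open>(1 - (norm (x - a))\<^sup>2 / \<delta>\<^sup>2) ^ N\<close> with \<open>N\<close> the largest even number
  not exceeding \<open>r\<close>.  On \<open>K\<close> it behaves like a Gaussian of width \<open>R = \<delta> / sqrt N\<close>.  Cutting space into shells of
  width \<open>R\<close> around \<open>a\<close> shows that its unnormalised first moment is at most a constant times \<open>R\<close> times the
  volume of a ball of radius \<open>R\<close> (\<open>peak_first_moment_le\<close>).  Conversely it is at least 1/2 on a ball of
  radius \<open>\<kappa> * R\<close> about \<open>a\<close>, and the density condition says that \<open>K\<close> fills a share \<open>\<eta>\<close> of that ball,
  so its mass is at least \<open>\<eta> * \<kappa> ^ n / 2\<close> times the volume of the ball of radius \<open>R\<close>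
  (\<open>peak_mass_ge\<close>).  The volumes cancel and the first moment of \<open>h\<close> is \<open>O (R / \<eta>)\<close>
  (\<open>localizing_sos\<close>).  The lower bound on \<open>r\<close> makes \<open>\<kappa> * R\<close> at most \<open>\<epsilon>K\<close>, the radius up
  to which the density condition holds, with a factor \<open>\<kappa>\<close> that does not depend on \<open>\<epsilon>K\<close>
  (\<open>ball_radius_le\<close>).  Therefore the final constant depends on \<open>K\<close> and \<open>\<eta>\<close> only.

  For polynomials on convex bodies it remains to bound the Lipschitz constant by a multiple of
  \<open>d\<^sup>2 * sup \<bar>f\<bar>\<close>.  This is a Markov inequality, which is needed only in one variable and at an endpoint
  of the interval (\<open>markov_endpoint\<close>): from each point \<open>x\<close> of \<open>K\<close> there are chords
  to all points of a ball contained in \<open>K\<close>; the directional derivative at \<open>x\<close> along each of them is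
  \<open>O (d\<^sup>2 * sup \<bar>f\<bar>)\<close>, and differences of these directions exhaust a ball around the origin, which bounds
  the whole gradient (\<open>gradient_bound\<close>).  Only the order of the bound matters, since a
  factor that depends on \<open>K\<close> alone is absorbed by the final constant.
\<close>

section \<open>Polynomials of bounded degree in several variables\<close>

lemma finite_multi_indices: "finite {\<alpha> :: 'n::finite \<Rightarrow> nat. (\<Sum>i\<in>UNIV. \<alpha> i) \<le> d}"
proof (rule finite_subset)
  show "{\<alpha> :: 'n \<Rightarrow> nat. (\<Sum>i\<in>UNIV. \<alpha> i) \<le> d} \<subseteq> (\<Pi>\<^sub>E i\<in>UNIV. {..d})"
  proof
    fix \<alpha> :: "'n \<Rightarrow> nat"
    assume "\<alpha> \<in> {\<alpha>. (\<Sum>i\<in>UNIV. \<alpha> i) \<le> d}"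
    then have "\<alpha> i \<le> d" for i
      using member_le_sum[of i UNIV \<alpha>] by simp
    then show "\<alpha> \<in> (\<Pi>\<^sub>E i\<in>UNIV. {..d})"
      by (simp add: PiE_UNIV_domain)
  qed
  show "finite (\<Pi>\<^sub>E i\<in>(UNIV :: 'n set). {..d})"
    by (rule finite_PiE) auto
qed

lemma polys_deg_leI: "(\<lambda>x. \<Sum>\<alpha> | (\<Sum>i\<in>UNIV. \<alpha> i) \<le> d. c \<alpha> * monomial_fun \<alpha> x) \<in> polys_deg_le d"
  by (auto simp: polys_deg_le_def)

lemma monomial_fun_in_polys_deg_le:
  assumes "(\<Sum>i\<in>UNIV. \<alpha> i) \<le> d"
  shows "monomial_fun \<alpha> \<in> polys_deg_le d"
proof -
  have "monomial_fun \<alpha> = (\<lambda>x. \<Sum>\<beta> | (\<Sum>i\<in>UNIV. \<beta> i) \<le> d. (if \<beta> = \<alpha> then 1 else 0) * monomial_fun \<beta> x)"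
    using assms by (simp add: if_distrib[of "\<lambda>c. c * _"] finite_multi_indices cong: if_cong)
  then show ?thesis
    by (auto simp: polys_deg_le_def)
qed

lemma polys_deg_le_add:
  assumes "p \<in> polys_deg_le d" "q \<in> polys_deg_le d"
  shows "(\<lambda>x. p x + q x) \<in> polys_deg_le d"
proof -
  obtain b c where "p = (\<lambda>x. \<Sum>\<alpha> | (\<Sum>i\<in>UNIV. \<alpha> i) \<le> d. b \<alpha> * monomial_fun \<alpha> x)"
    "q = (\<lambda>x. \<Sum>\<alpha> | (\<Sum>i\<in>UNIV. \<alpha> i) \<le> d. c \<alpha> * monomial_fun \<alpha> x)"
    using assms by (auto simp: polys_deg_le_def)
  then have "(\<lambda>x. p x + q x) = (\<lambda>x. \<Sum>\<alpha> | (\<Sum>i\<in>UNIV. \<alpha> i) \<le> d. (b \<alpha> + c \<alpha>) * monomial_fun \<alpha> x)"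
    by (simp add: sum.distrib distrib_right)
  then show ?thesis
    by (simp only: polys_deg_leI)
qed

lemma polys_deg_le_scale:
  assumes "p \<in> polys_deg_le d"
  shows "(\<lambda>x. k * p x) \<in> polys_deg_le d"
proof -
  obtain c where "p = (\<lambda>x. \<Sum>\<alpha> | (\<Sum>i\<in>UNIV. \<alpha> i) \<le> d. c \<alpha> * monomial_fun \<alpha> x)"
    using assms by (auto simp: polys_deg_le_def)
  then have "(\<lambda>x. k * p x) = (\<lambda>x. \<Sum>\<alpha> | (\<Sum>i\<in>UNIV. \<alpha> i) \<le> d. (k * c \<alpha>) * monomial_fun \<alpha> x)"
    by (simp add: sum_distrib_left mult.assoc)
  then show ?thesis
    by (simp only: polys_deg_leI)
qed

lemma polys_deg_le_const: "(\<lambda>x. k) \<in> polys_deg_le d"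
  using polys_deg_le_scale[OF monomial_fun_in_polys_deg_le[of "\<lambda>_. 0"], of d k]
  by (simp add: monomial_fun_def)

lemma polys_deg_le_sum:
  assumes "\<And>j. j \<in> J \<Longrightarrow> p j \<in> polys_deg_le d"
  shows "(\<lambda>x. \<Sum>j\<in>J. p j x) \<in> polys_deg_le d"
  using assms
  by (induction J rule: infinite_finite_induct) (simp_all add: polys_deg_le_const polys_deg_le_add)

lemma polys_deg_le_mono:
  assumes "p \<in> polys_deg_le d" "d \<le> e"
  shows "p \<in> polys_deg_le e"
proof -
  obtain c where p: "p = (\<lambda>x. \<Sum>\<alpha> | (\<Sum>i\<in>UNIV. \<alpha> i) \<le> d. c \<alpha> * monomial_fun \<alpha> x)"
    using assms by (auto simp: polys_deg_le_def)
  show ?thesis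
    unfolding p using assms(2)
    by (intro polys_deg_le_sum polys_deg_le_scale monomial_fun_in_polys_deg_le) simp
qed

lemma polys_deg_le_mult:
  assumes "p \<in> polys_deg_le d" "q \<in> polys_deg_le e"
  shows "(\<lambda>x. p x * q x) \<in> polys_deg_le (d + e)"
proof -
  obtain b c where p: "p = (\<lambda>x. \<Sum>\<alpha> | (\<Sum>i\<in>UNIV. \<alpha> i) \<le> d. b \<alpha> * monomial_fun \<alpha> x)"
    and q: "q = (\<lambda>x. \<Sum>\<beta> | (\<Sum>i\<in>UNIV. \<beta> i) \<le> e. c \<beta> * monomial_fun \<beta> x)"
    using assms by (auto simp: polys_deg_le_def)
  have "p x * q x = (\<Sum>\<alpha> | (\<Sum>i\<in>UNIV. \<alpha> i) \<le> d. \<Sum>\<beta> | (\<Sum>i\<in>UNIV. \<beta> i) \<le> e.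
      (b \<alpha> * c \<beta>) * monomial_fun (\<lambda>i. \<alpha> i + \<beta> i) x)" for x
    by (simp add: p q sum_product monomial_fun_def power_add prod.distrib mult_ac)
  moreover have "(\<lambda>x. \<Sum>\<alpha> | (\<Sum>i\<in>UNIV. \<alpha> i) \<le> d. \<Sum>\<beta> | (\<Sum>i\<in>UNIV. \<beta> i) \<le> e.
      (b \<alpha> * c \<beta>) * monomial_fun (\<lambda>i. \<alpha> i + \<beta> i) x) \<in> polys_deg_le (d + e)"
    by (intro polys_deg_le_sum polys_deg_le_scale monomial_fun_in_polys_deg_le)
      (simp add: sum.distrib add_mono)
  ultimately show ?thesis
    by presburger
qed

lemma polys_deg_le_power:
  assumes "p \<in> polys_deg_le d"
  shows "(\<lambda>x. p x ^ k) \<in> polys_deg_le (k * d)"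
  by (induction k) (simp_all add: polys_deg_le_const polys_deg_le_mult[OF assms])

lemma coordinate_in_polys_deg_le: "(\<lambda>x. x $ i) \<in> polys_deg_le 1"
proof -
  have "monomial_fun (\<lambda>j. if j = i then 1 else 0) = (\<lambda>x. x $ i)"
    by (simp add: monomial_fun_def fun_eq_iff if_distrib[of "power _"] prod.delta cong: if_cong)
  moreover have "monomial_fun (\<lambda>j. if j = i then 1 else 0) \<in> polys_deg_le 1"
    by (rule monomial_fun_in_polys_deg_le) simp
  ultimately show ?thesis
    by simp
qed

lemma real_polynomial_function_polys_deg_le:
  fixes f :: "real ^ 'n::finite \<Rightarrow> real"
  assumes "f \<in> polys_deg_le d"
  shows "real_polynomial_function f"
proof -
  have coord: "real_polynomial_function (\<lambda>x :: real ^ 'n. x $ i)" for i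
    by (intro real_polynomial_function.intros(1) bounded_linear_vec_nth)
  obtain c where f: "f = (\<lambda>x. \<Sum>\<alpha> | (\<Sum>i\<in>UNIV. \<alpha> i) \<le> d. c \<alpha> * monomial_fun \<alpha> x)"
    using assms by (auto simp: polys_deg_le_def)
  have "real_polynomial_function (monomial_fun \<alpha> :: real ^ 'n \<Rightarrow> real)" for \<alpha>
    unfolding monomial_fun_def[abs_def]
    by (rule real_polynomial_function_prod[OF finite real_polynomial_function_power[OF coord]])
  then have "real_polynomial_function (\<lambda>x :: real ^ 'n. c \<alpha> * monomial_fun \<alpha> x)" for \<alpha>
    by (rule real_polynomial_function.intros(4)[OF real_polynomial_function.intros(2)])
  then show ?thesis
    unfolding f by (rule real_polynomial_function_sum[OF finite_multi_indices])
qed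

lemma poly_on_line:
  fixes f :: "real ^ 'n::finite \<Rightarrow> real"
  assumes "f \<in> polys_deg_le d"
  obtains p :: "real poly" where "degree p \<le> d" "\<And>t. f (x + t *\<^sub>R v) = poly p t"
proof -
  obtain c where f: "f = (\<lambda>x. \<Sum>\<alpha> | (\<Sum>i\<in>UNIV. \<alpha> i) \<le> d. c \<alpha> * monomial_fun \<alpha> x)"
    using assms by (auto simp: polys_deg_le_def)
  define m :: "('n \<Rightarrow> nat) \<Rightarrow> real poly" where "m = (\<lambda>\<alpha>. \<Prod>i\<in>UNIV. [:x $ i, v $ i:] ^ \<alpha> i)"
  define p where "p = (\<Sum>\<alpha> | (\<Sum>i\<in>UNIV. \<alpha> i) \<le> d. smult (c \<alpha>) (m \<alpha>))"
  have deg_m: "degree (m \<alpha>) \<le> (\<Sum>i\<in>UNIV. \<alpha> i)" for \<alpha>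
  proof -
    have "degree (m \<alpha>) \<le> (\<Sum>i\<in>UNIV. degree ([:x $ i, v $ i:] ^ \<alpha> i))"
      using degree_prod_sum_le[of UNIV "\<lambda>i. [:x $ i, v $ i:] ^ \<alpha> i"] by (simp add: m_def o_def)
    also have "\<dots> \<le> (\<Sum>i\<in>UNIV. \<alpha> i)"
    proof (rule sum_mono)
      fix i
      have "degree ([:x $ i, v $ i:] ^ \<alpha> i) \<le> degree [:x $ i, v $ i:] * \<alpha> i"
        by (rule degree_power_le)
      also have "\<dots> \<le> 1 * \<alpha> i"
        by (rule mult_right_mono) auto
      finally show "degree ([:x $ i, v $ i:] ^ \<alpha> i) \<le> \<alpha> i"
        by simp
    qed
    finally show ?thesis .
  qed
  have "degree (smult (c \<alpha>) (m \<alpha>)) \<le> d" if "(\<Sum>i\<in>UNIV. \<alpha> i) \<le> d" for \<alpha>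
    using order_trans[OF deg_m[of \<alpha>] that] degree_smult_le[of "c \<alpha>" "m \<alpha>"] by linarith
  then have "degree p \<le> d"
    unfolding p_def by (intro degree_sum_le[OF finite_multi_indices]) simp
  moreover have "f (x + t *\<^sub>R v) = poly p t" for t
    by (simp add: f p_def m_def monomial_fun_def poly_sum poly_prod mult.commute)
  ultimately show thesis
    by (rule that)
qed

section \<open>Markov's inequality at an endpoint\<close>

lemma poly_eq_sum_atMost:
  fixes p :: "real poly"
  assumes "degree p \<le> d"
  shows "poly p x = (\<Sum>k\<le>d. coeff p k * x ^ k)"
  using assms unfolding poly_altdef
  by (intro sum.mono_neutral_left) (auto simp: coeff_eq_0)

text \<open>The two roots of \<open>w\<^sup>2 - 2 * z * w + 1 = 0\<close> have product 1, so one of them lies in the closed unit disc.\<close>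

lemma joukowski_preimage:
  fixes z :: complex
  obtains w where "w \<noteq> 0" "norm w \<le> 1" "z = (w + 1 / w) / 2"
proof -
  define u where "u = z + csqrt (z\<^sup>2 - 1)"
  define v where "v = z - csqrt (z\<^sup>2 - 1)"
  have uv: "u * v = 1"
    by (simp add: u_def v_def algebra_simps flip: power2_eq_square)
  have s: "u + v = 2 * z"
    by (simp add: u_def v_def)
  have nz: "u \<noteq> 0" "v \<noteq> 0"
    using uv by auto
  have u_eq: "1 / u = v" and v_eq: "1 / v = u"
    using uv nz by (simp_all add: field_simps)
  have "norm u * norm v = 1"
    using uv by (metis norm_mult norm_one)
  then consider "norm u \<le> 1" | "norm v \<le> 1"
    by (metis less_1_mult less_irrefl not_le)
  then show thesis
  proof cases
    case 1
    show ?thesis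
      by (rule that[of u]) (use nz 1 s in \<open>simp_all add: u_eq\<close>)
  next
    case 2
    show ?thesis
      by (rule that[of v]) (use nz 2 s in \<open>simp_all add: v_eq add.commute\<close>)
  qed
qed

text \<open>The Bernstein--Walsh growth estimate.  The Joukowski map \<open>w \<mapsto> (w + 1 / w) / 2\<close> sends the unit circle onto
  \<open>[-1, 1]\<close>, where \<open>p\<close> is bounded by assumption.  After multiplication by \<open>w ^ d\<close> the composition with \<open>p\<close>
  is a polynomial in \<open>w\<close>, so the maximum principle carries the bound from the circle into the disc.\<close>

lemma joukowski_growth:
  fixes p :: "real poly" and w :: complex
  assumes deg: "degree p \<le> d"
    and bound: "\<And>x. \<bar>x\<bar> \<le> 1 \<Longrightarrow> \<bar>poly p x\<bar> \<le> M"
    and w: "w \<noteq> 0" "norm w \<le> 1"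
  shows "norm (\<Sum>k\<le>d. of_real (coeff p k) * ((w + 1 / w) / 2) ^ k) * norm w ^ d \<le> M"
proof -
  \<comment> \<open>\<open>Q w = w ^ d * p ((w + 1 / w) / 2)\<close> with the denominators cleared, hence holomorphic at 0 too.\<close>
  define Q :: "complex \<Rightarrow> complex"
    where "Q = (\<lambda>w. \<Sum>k\<le>d. of_real (coeff p k) * (w ^ (d - k) * ((w\<^sup>2 + 1) / 2) ^ k))"
  have Q_eq: "Q u = (\<Sum>k\<le>d. of_real (coeff p k) * ((u + 1 / u) / 2) ^ k) * u ^ d" if "u \<noteq> 0" for u
  proof -
    have "u ^ (d - k) * ((u\<^sup>2 + 1) / 2) ^ k = ((u + 1 / u) / 2) ^ k * u ^ d" if "k \<le> d" for k
    proof -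
      have "(u\<^sup>2 + 1) / 2 = ((u + 1 / u) / 2) * u"
        using \<open>u \<noteq> 0\<close> by (simp add: field_simps power2_eq_square)
      then have "u ^ (d - k) * ((u\<^sup>2 + 1) / 2) ^ k = ((u + 1 / u) / 2) ^ k * (u ^ (d - k) * u ^ k)"
        by (simp only: power_mult_distrib mult_ac)
      then show ?thesis
        using \<open>k \<le> d\<close> by (simp flip: power_add)
    qed
    then show ?thesis
      unfolding Q_def by (simp add: sum_distrib_right mult.assoc)
  qed
  have "norm (Q w) \<le> M"
  proof (rule maximum_modulus_frontier[of Q "cball 0 1"])
    show "Q holomorphic_on interior (cball 0 1)"
      unfolding Q_def by (intro holomorphic_intros) auto
    show "continuous_on (closure (cball 0 1)) Q"
      unfolding Q_def by (intro continuous_intros) auto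
    show "w \<in> cball 0 1"
      using w by simp
    fix u :: complex assume "u \<in> frontier (cball 0 1)"
    then have u: "norm u = 1" "u \<noteq> 0"
      by auto
    \<comment> \<open>On the unit circle \<open>1 / u\<close> is the conjugate of \<open>u\<close>, so \<open>p\<close> is evaluated at \<open>Re u\<close>.\<close>
    have "(u + 1 / u) / 2 = of_real (Re u)"
      using u by (simp add: divide_conv_cnj complex_add_cnj)
    then have "Q u = of_real (poly p (Re u)) * u ^ d"
      by (simp add: Q_eq[OF u(2)] poly_eq_sum_atMost[OF deg] flip: of_real_power of_real_mult of_real_sum)
    then show "norm (Q u) \<le> M"
      using u bound[of "Re u"] abs_Re_le_cmod[of u] by (simp add: norm_mult norm_power)
  qed (auto)
  then show ?thesis
    by (simp add: Q_eq[OF w(1)] norm_mult norm_power)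
qed

text \<open>The derivative at 1 is controlled by Cauchy's inequality on a circle of radius \<open>\<delta>\<close> of order \<open>1 / d\<^sup>2\<close>.
  The radius can be that large because the Joukowski map has a critical point over 1: a point at distance
  \<open>\<delta>\<close> from 1 has a preimage at distance at most \<open>sqrt (2 * \<delta>)\<close> from 1, so that \<open>norm w ^ d\<close> stays away
  from 0 and \<open>p\<close> is at most \<open>2 * M\<close> on the circle.  The sharp constant is 1 instead of 16.\<close>

lemma markov_endpoint:
  fixes p :: "real poly"
  assumes deg: "degree p \<le> d"
    and bound: "\<And>x. \<bar>x\<bar> \<le> 1 \<Longrightarrow> \<bar>poly p x\<bar> \<le> M"
  shows "\<bar>poly (pderiv p) 1\<bar> \<le> 16 * (real d)\<^sup>2 * M"
proof (cases "d = 0")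
  case True
  then show ?thesis
    using deg by (auto elim: degree_eq_zeroE)
next
  case False
  \<comment> \<open>The largest radius, up to a constant, for which the growth factor \<open>norm w ^ (- d)\<close> stays at most 2.\<close>
  define \<delta> where "\<delta> = 1 / (8 * (real d)\<^sup>2)"
  have \<delta>: "\<delta> > 0"
    using False by (simp add: \<delta>_def)
  define P :: "complex \<Rightarrow> complex" where "P = (\<lambda>z. \<Sum>k\<le>d. of_real (coeff p k) * z ^ k)"
  have P': "(P has_field_derivative of_real (poly (pderiv p) 1)) (at 1)"
  proof -
    have "(P has_field_derivative (\<Sum>k\<le>d. of_real (coeff p k) * of_nat k)) (at 1)"
      unfolding P_def by (auto intro!: derivative_eq_intros sum.cong)
    moreover have "poly (pderiv p) 1 = (\<Sum>k\<le>d. coeff p k * of_nat k)"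
    proof -
      have "poly p = (\<lambda>x. \<Sum>k\<le>d. coeff p k * x ^ k)"
        using poly_eq_sum_atMost[OF deg] by blast
      then have "(poly p has_field_derivative (\<Sum>k\<le>d. coeff p k * of_nat k)) (at 1)"
        by (auto intro!: derivative_eq_intros sum.cong)
      then show ?thesis
        using poly_DERIV DERIV_unique by blast
    qed
    ultimately show ?thesis
      by simp
  qed
  have P_bound: "norm (P z) \<le> 2 * M" if z: "norm (1 - z) = \<delta>" for z
  proof -
    obtain w where w: "w \<noteq> 0" "norm w \<le> 1" and zw: "z = (w + 1 / w) / 2"
      by (rule joukowski_preimage)
    have "(1 - w)\<^sup>2 = - 2 * w * (1 - z)"
      using w by (simp add: zw field_simps power2_eq_square)
    then have "(norm (1 - w))\<^sup>2 = 2 * norm w * \<delta>"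
      using z by (metis norm_minus_cancel norm_mult norm_numeral norm_power)
    also have "\<dots> \<le> (1 / (2 * real d))\<^sup>2"
      using w \<delta> mult_right_mono[of "norm w" 1 \<delta>] by (simp add: \<delta>_def power_divide power_mult_distrib)
    finally have "norm (1 - w) \<le> 1 / (2 * real d)"
      by (rule power2_le_imp_le) simp
    then have "1 - 1 / (2 * real d) \<le> norm w"
      using norm_triangle_ineq2[of 1 "1 - w"] by simp
    moreover have "1 / (2 * real d) \<le> 1"
      using False by simp
    ultimately have "(1 - 1 / (2 * real d)) ^ d \<le> norm w ^ d"
      by (intro power_mono) auto
    moreover have "1 / 2 \<le> (1 - 1 / (2 * real d)) ^ d"
      using Bernoulli_inequality[of "- 1 / (2 * real d)" d] False by simp
    ultimately have "1 / 2 \<le> norm w ^ d"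
      by linarith
    then have "norm (P z) * (1 / 2) \<le> norm (P z) * norm w ^ d"
      by (intro mult_left_mono) auto
    also have "\<dots> \<le> M"
      using joukowski_growth[OF deg bound w] by (simp add: P_def zw)
    finally show ?thesis
      by simp
  qed
  have "norm ((deriv ^^ 1) P 1) \<le> fact 1 * (2 * M) / \<delta> ^ 1"
    by (rule Cauchy_inequality[OF _ _ \<delta> P_bound])
      (auto simp: P_def intro!: holomorphic_intros continuous_intros)
  then show ?thesis
    using DERIV_imp_deriv[OF P'] by (simp add: \<delta>_def mult_ac)
qed

section \<open>Lipschitz constants of polynomials on convex bodies\<close>

lemma derivative_bound_along_chord:
  fixes f :: "real ^ 'n::finite \<Rightarrow> real"
  assumes f: "f \<in> polys_deg_le d"
    and f': "(f has_derivative f') (at x)"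
    and bound: "\<And>t. 0 \<le> t \<Longrightarrow> t \<le> 1 \<Longrightarrow> \<bar>f (x + t *\<^sub>R v)\<bar> \<le> S"
  shows "\<bar>f' v\<bar> \<le> 32 * (real d)\<^sup>2 * S"
proof -
  \<comment> \<open>The chord is reparametrised by \<open>[-1, 1]\<close> so that its endpoint \<open>x\<close> sits at \<open>t = 1\<close>.\<close>
  obtain p where deg: "degree p \<le> d" and p: "\<And>t. f ((x + v /\<^sub>R 2) + t *\<^sub>R (- v /\<^sub>R 2)) = poly p t"
    using poly_on_line[OF f] by blast
  have p_chord: "poly p t = f (x + ((1 - t) / 2) *\<^sub>R v)" for t
    unfolding p[symmetric] by (rule arg_cong[where f = f]) (simp add: algebra_simps diff_divide_distrib)
  have "\<bar>poly (pderiv p) 1\<bar> \<le> 16 * (real d)\<^sup>2 * S"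
    by (rule markov_endpoint[OF deg]) (use bound in \<open>auto simp: p_chord abs_le_iff\<close>)
  moreover have "((\<lambda>t. f (x + ((1 - t) / 2) *\<^sub>R v)) has_derivative (\<lambda>t. f' ((- t / 2) *\<^sub>R v))) (at 1)"
    by (rule has_derivative_compose[where g = f, of "\<lambda>t. x + ((1 - t) / 2) *\<^sub>R v"])
      (auto intro!: derivative_eq_intros simp: f')
  then have "(poly p has_derivative (\<lambda>t. f' ((- t / 2) *\<^sub>R v))) (at 1)"
    by (simp flip: p_chord)
  then have "poly (pderiv p) 1 = f' ((- 1 / 2) *\<^sub>R v)"
    using fun_cong[OF has_derivative_unique[OF poly_DERIV[of p 1, unfolded has_field_derivative_def]], of _ 1]
    by simp
  then have "poly (pderiv p) 1 = - 1 / 2 * f' v"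
    by (simp only: linear_scale[OF has_derivative_linear[OF f']] real_scaleR_def)
  ultimately show ?thesis
    by simp
qed

text \<open>For every \<open>e\<close> of norm \<open>\<rho>\<close> the chords from \<open>x\<close> to \<open>z + e\<close> and to \<open>z - e\<close> stay in \<open>K\<close>.  The difference of
  their directions is \<open>2 * e\<close>, so bounding the derivative along both of them bounds it along \<open>e\<close>.\<close>

lemma gradient_bound:
  fixes f :: "real ^ 'n::finite \<Rightarrow> real"
  assumes f: "f \<in> polys_deg_le d"
    and f': "(f has_derivative f') (at x)"
    and K: "convex K" "cball z \<rho> \<subseteq> K" "\<rho> > 0" "x \<in> K"
    and bound: "\<And>y. y \<in> K \<Longrightarrow> \<bar>f y\<bar> \<le> S"
  shows "onorm f' \<le> 32 * (real d)\<^sup>2 * S / \<rho>"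
proof (rule onorm_le)
  fix u :: "real ^ 'n"
  note lin = has_derivative_linear[OF f']
  have chord: "\<bar>f' (y - x)\<bar> \<le> 32 * (real d)\<^sup>2 * S" if "y \<in> K" for y
  proof (rule derivative_bound_along_chord[OF f f'])
    fix t :: real assume t: "0 \<le> t" "t \<le> 1"
    have "x + t *\<^sub>R (y - x) = (1 - t) *\<^sub>R x + t *\<^sub>R y"
      by (simp add: algebra_simps)
    then have "x + t *\<^sub>R (y - x) \<in> K"
      using convexD_alt[OF K(1) K(4) that t] by simp
    then show "\<bar>f (x + t *\<^sub>R (y - x))\<bar> \<le> S"
      by (rule bound)
  qed
  show "norm (f' u) \<le> 32 * (real d)\<^sup>2 * S / \<rho> * norm u"
  proof (cases "u = 0")
    case True
    then show ?thesis
      using linear_0[OF lin] by simp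
  next
    case False
    define e where "e = (\<rho> / norm u) *\<^sub>R u"
    have "norm e = \<rho>"
      using False K by (simp add: e_def)
    then have "z + e \<in> K" "z - e \<in> K"
      by (auto intro!: subsetD[OF K(2)] simp: dist_norm)
    from chord[OF this(1)] chord[OF this(2)]
    have "\<bar>f' (z + e - x) - f' (z - e - x)\<bar> \<le> 2 * (32 * (real d)\<^sup>2 * S)"
      by linarith
    also have "f' (z + e - x) = f' (z - e - x) + f' (e + e)"
      unfolding linear_add[OF lin, symmetric] by (rule arg_cong[where f = f']) simp
    also have "f' (z - e - x) + f' (e + e) - f' (z - e - x) = 2 * f' e"
      using linear_add[OF lin, of e e] by simp
    finally have "\<bar>f' e\<bar> \<le> 32 * (real d)\<^sup>2 * S"
      by simp
    then have "\<rho> * \<bar>f' u\<bar> / norm u \<le> 32 * (real d)\<^sup>2 * S"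
      using K by (simp add: e_def linear_scale[OF lin] abs_mult)
    then show ?thesis
      using False K by (simp add: field_simps)
  qed
qed

lemma markov_lipschitz:
  fixes f :: "real ^ 'n::finite \<Rightarrow> real"
  assumes f: "f \<in> polys_deg_le d"
    and K: "convex K" "cball z \<rho> \<subseteq> K" "\<rho> > 0"
    and bound: "\<And>y. y \<in> K \<Longrightarrow> \<bar>f y\<bar> \<le> S"
  shows "(32 * (real d)\<^sup>2 * S / \<rho>)-lipschitz_on K f"
proof (rule bounded_derivative_imp_lipschitz)
  have f': "(f has_derivative frechet_derivative f (at x)) (at x)" for x
    using differentiable_at_real_polynomial_function[OF real_polynomial_function_polys_deg_le[OF f]]
    by (simp add: frechet_derivative_works)
  show "(f has_derivative frechet_derivative f (at x)) (at x within K)" for x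
    using f' by (rule has_derivative_at_withinI)
  show "onorm (frechet_derivative f (at x)) \<le> 32 * (real d)\<^sup>2 * S / \<rho>" if "x \<in> K" for x
    by (rule gradient_bound[OF f f' K that bound])
  have "0 \<le> S"
    using bound[of z] K by (force intro: order_trans[OF abs_ge_zero])
  then show "0 \<le> 32 * (real d)\<^sup>2 * S / \<rho>"
    using K by simp
qed (rule K)

lemma convex_body_contains_cball:
  assumes "convex_body (K :: (real ^ 'n::finite) set)"
  obtains z \<rho> where "\<rho> > 0" "cball z \<rho> \<subseteq> K"
proof -
  have "interior K \<noteq> {}"
    using assms rel_interior_eq_empty[of K] by (auto simp: convex_body_def interior_rel_interior_gen)
  then obtain z where "z \<in> interior K"
    by blast
  then show thesis
    using that by (auto simp: mem_interior_cball)
qed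

text \<open>Two different parallel supporting hyperplanes enclose \<open>K\<close>, hence also the ball.  That such a pair exists has
  to be checked as well, because the infimum of the empty set of widths would carry no information.\<close>

lemma min_width_ge:
  fixes K :: "(real ^ 'n::finite) set"
  assumes "compact K" "cball z \<rho> \<subseteq> K" "\<rho> > 0"
  shows "2 * \<rho> \<le> min_width K"
  unfolding min_width_def
proof (rule cInf_greatest)
  let ?W = "{setdist {x. u \<bullet> x = b} {x. u \<bullet> x = c} | u b c.
            supports_at K u b \<and> supports_at K u c \<and> b \<noteq> c}"
  show "?W \<noteq> {}"
  proof -
    obtain u :: "real ^ 'n" where u: "norm u = 1"
      using vector_choose_size[of 1] by auto
    then have "u \<noteq> 0"
      by auto
    have "z \<in> K"
      using subsetD[OF assms(2), of z] assms(3) by simp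
    have cont: "continuous_on K (\<lambda>x. u \<bullet> x)"
      by (intro continuous_intros)
    obtain x where x: "x \<in> K" "\<And>y. y \<in> K \<Longrightarrow> u \<bullet> y \<le> u \<bullet> x"
      using continuous_attains_sup[OF assms(1) _ cont] \<open>z \<in> K\<close> by (metis empty_iff)
    obtain y where y: "y \<in> K" "\<And>x. x \<in> K \<Longrightarrow> u \<bullet> y \<le> u \<bullet> x"
      using continuous_attains_inf[OF assms(1) _ cont] \<open>z \<in> K\<close> by (metis empty_iff)
    have "z + \<rho> *\<^sub>R u \<in> K" "z - \<rho> *\<^sub>R u \<in> K"
      using u assms(3) by (auto intro!: subsetD[OF assms(2)] simp: dist_norm)
    from x(2)[OF this(1)] y(2)[OF this(2)] have "u \<bullet> z + \<rho> \<le> u \<bullet> x" "u \<bullet> y \<le> u \<bullet> z - \<rho>"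
      using u by (simp_all add: inner_add_right inner_diff_right norm_eq_1)
    then have "u \<bullet> y < u \<bullet> x"
      using assms(3) by linarith
    moreover have "supports_at K u (u \<bullet> x)" "supports_at K u (u \<bullet> y)"
      using x y \<open>u \<noteq> 0\<close> by (auto simp: supports_at_def)
    ultimately have "setdist {v. u \<bullet> v = u \<bullet> x} {v. u \<bullet> v = u \<bullet> y} \<in> ?W"
      by (intro CollectI exI[of _ u] exI[of _ "u \<bullet> x"] exI[of _ "u \<bullet> y"]) simp
    then show ?thesis
      by (metis empty_iff)
  qed
  fix w assume "w \<in> ?W"
  then obtain u b c where w: "w = setdist {x. u \<bullet> x = b} {x. u \<bullet> x = c}"
    and supp: "supports_at K u b" "supports_at K u c" and "b \<noteq> c"
    by blast
  have u: "u \<noteq> 0"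
    using supp by (simp add: supports_at_def)
  \<comment> \<open>Two supporting hyperplanes on the same side coincide, so \<open>K\<close> lies between these two.\<close>
  have between: "(\<forall>x\<in>K. b \<le> u \<bullet> x \<and> u \<bullet> x \<le> c) \<or> (\<forall>x\<in>K. c \<le> u \<bullet> x \<and> u \<bullet> x \<le> b)"
  proof -
    obtain x y where x: "x \<in> K" "b = u \<bullet> x" and y: "y \<in> K" "c = u \<bullet> y"
      using supp by (auto simp: supports_at_def)
    have not_below: "\<not> ((\<forall>v\<in>K. u \<bullet> v \<le> b) \<and> (\<forall>v\<in>K. u \<bullet> v \<le> c))"
      using bspec[of K "\<lambda>v. u \<bullet> v \<le> b" y] bspec[of K "\<lambda>v. u \<bullet> v \<le> c" x] x y \<open>b \<noteq> c\<close>
      by linarith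
    have not_above: "\<not> ((\<forall>v\<in>K. b \<le> u \<bullet> v) \<and> (\<forall>v\<in>K. c \<le> u \<bullet> v))"
      using bspec[of K "\<lambda>v. b \<le> u \<bullet> v" y] bspec[of K "\<lambda>v. c \<le> u \<bullet> v" x] x y \<open>b \<noteq> c\<close>
      by linarith
    have "(\<forall>v\<in>K. u \<bullet> v \<le> b) \<or> (\<forall>v\<in>K. b \<le> u \<bullet> v)" "(\<forall>v\<in>K. u \<bullet> v \<le> c) \<or> (\<forall>v\<in>K. c \<le> u \<bullet> v)"
      using supp by (auto simp: supports_at_def)
    with not_below not_above show ?thesis
      by blast
  qed
  define e where "e = (\<rho> / norm u) *\<^sub>R u"
  have "norm e = \<rho>"
    using u assms by (simp add: e_def)
  then have "z + e \<in> K" "z - e \<in> K"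
    by (auto intro!: subsetD[OF assms(2)] simp: dist_norm)
  have ue: "u \<bullet> e = \<rho> * norm u"
    using u by (simp add: e_def dot_square_norm power2_eq_square)
  have bc: "2 * \<rho> * norm u \<le> \<bar>b - c\<bar>"
    using between
  proof
    assume "\<forall>x\<in>K. b \<le> u \<bullet> x \<and> u \<bullet> x \<le> c"
    then have "b \<le> u \<bullet> (z - e)" "u \<bullet> (z + e) \<le> c"
      using \<open>z - e \<in> K\<close> \<open>z + e \<in> K\<close> by blast+
    then show ?thesis
      using ue by (simp add: inner_add_right inner_diff_right)
  next
    assume "\<forall>x\<in>K. c \<le> u \<bullet> x \<and> u \<bullet> x \<le> b"
    then have "c \<le> u \<bullet> (z - e)" "u \<bullet> (z + e) \<le> b"
      using \<open>z - e \<in> K\<close> \<open>z + e \<in> K\<close> by blast+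
    then show ?thesis
      using ue by (simp add: inner_add_right inner_diff_right)
  qed
  have ne: "\<exists>x. u \<bullet> x = b" "\<exists>x. u \<bullet> x = c"
    using supp by (auto simp: supports_at_def)
  have "2 * \<rho> \<le> dist x y" if "u \<bullet> x = b" "u \<bullet> y = c" for x y
  proof -
    have "\<bar>b - c\<bar> \<le> norm u * norm (x - y)"
      using Cauchy_Schwarz_ineq2[of u "x - y"] that by (simp add: inner_diff_right)
    with bc have "norm u * (2 * \<rho>) \<le> norm u * norm (x - y)"
      by (simp add: mult_ac)
    then show ?thesis
      using u by (simp add: dist_norm)
  qed
  then show "2 * \<rho> \<le> w"
    using ne by (auto simp: w le_setdist_iff)
qed

text \<open>The Lipschitz constant is put in the shape in which the minimal width occurs in the final estimate.  The
  minimal width is positive by \<open>min_width_ge\<close>, so the division is a genuine one.\<close>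

lemma convex_body_markov_const:
  fixes K :: "(real ^ 'n::finite) set"
  assumes "convex_body K"
  obtains C where "C \<ge> 1" "\<And>f d. polynomial_of_degree d f \<Longrightarrow>
    (2 * (real d)\<^sup>2 * C * (SUP x\<in>K. \<bar>f x\<bar>) / min_width K)-lipschitz_on K f"
proof -
  have K: "compact K" "convex K"
    using assms by (auto simp: convex_body_def)
  obtain z \<rho> where \<rho>: "\<rho> > 0" "cball z \<rho> \<subseteq> K"
    using convex_body_contains_cball[OF assms] .
  have width: "2 * \<rho> \<le> min_width K"
    by (rule min_width_ge[OF K(1) \<rho>(2,1)])
  \<comment> \<open>Both sizes of \<open>K\<close> are fixed, so trading \<open>\<rho>\<close> for \<open>min_width K\<close> costs only a constant.\<close>
  define C where "C = 16 * min_width K / \<rho>"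
  have "C \<ge> 1"
    using width \<rho> by (simp add: C_def)
  moreover have "(2 * (real d)\<^sup>2 * C * (SUP x\<in>K. \<bar>f x\<bar>) / min_width K)-lipschitz_on K f"
    if "polynomial_of_degree d f" for f d
  proof -
    have f: "f \<in> polys_deg_le d"
      using that by (simp add: polynomial_of_degree_def)
    have "continuous_on K f"
      using continuous_real_polymonial_function[OF real_polynomial_function_polys_deg_le[OF f]]
      by (simp add: continuous_at_imp_continuous_on)
    then have "compact ((\<lambda>x. \<bar>f x\<bar>) ` K)"
      using K by (intro compact_continuous_image continuous_intros)
    then have "\<bar>f y\<bar> \<le> (SUP x\<in>K. \<bar>f x\<bar>)" if "y \<in> K" for y
      using that by (intro cSUP_upper bounded_imp_bdd_above compact_imp_bounded)
    then have "(32 * (real d)\<^sup>2 * (SUP x\<in>K. \<bar>f x\<bar>) / \<rho>)-lipschitz_on K f"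
      by (rule markov_lipschitz[OF f K(2) \<rho>(2,1)])
    then show ?thesis
      using width \<rho> by (simp add: C_def field_simps)
  qed
  ultimately show thesis
    by (rule that)
qed

section \<open>Bounding the relaxation by a first moment\<close>

lemma sos_polys_nonneg: "h \<in> sos_polys r \<Longrightarrow> 0 \<le> h x"
  by (auto simp: sos_polys_def intro: sum_nonneg)

lemma continuous_on_sos_polys:
  fixes h :: "real ^ 'n::finite \<Rightarrow> real"
  assumes "h \<in> sos_polys r"
  shows "continuous_on K h"
proof -
  obtain m and q :: "nat \<Rightarrow> real ^ 'n \<Rightarrow> real" where q: "\<And>j. j < m \<Longrightarrow> real_polynomial_function (q j)"
    and h: "h = (\<lambda>x. \<Sum>j<m. (q j x)\<^sup>2)"
    using assms by (auto simp: sos_polys_def)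
  have "continuous_on K (q j)" if "j < m" for j
    using continuous_real_polymonial_function[OF q[OF that]]
    by (simp add: continuous_at_imp_continuous_on)
  then show ?thesis
    unfolding h by (intro continuous_intros) simp
qed

lemma set_integrable_lebesgue_compact:
  fixes f :: "'a::euclidean_space \<Rightarrow> real"
  assumes "compact K" "continuous_on K f"
  shows "set_integrable lebesgue K f"
  using borel_integrable_compact[OF assms] integrable_completion[of _ lborel] borel_measurable_integrable
  unfolding set_integrable_def by blast

text \<open>The infimum is taken in the reals, so it is known to be below each of the values only once they
  are bounded below.  They are: each value is a mean of \<open>f\<close> over \<open>K\<close> and hence at least the minimum of \<open>f\<close>.\<close>

lemma lasserre_upper_le:
  assumes "compact K" "K \<noteq> {}" "continuous_on K f"
    and h: "h \<in> sos_polys r" "(LINT x:K|lebesgue. h x) = 1"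
  shows "lasserre_upper K f r \<le> (LINT x:K|lebesgue. h x * f x)"
  unfolding lasserre_upper_def
proof (rule cInf_lower)
  obtain a where a: "a \<in> K" "\<And>x. x \<in> K \<Longrightarrow> f a \<le> f x"
    using continuous_attains_inf[OF assms(1-3)] by blast
  have "f a \<le> (LINT x:K|lebesgue. g x * f x)"
    if g: "g \<in> sos_polys r" "(LINT x:K|lebesgue. g x) = 1" for g
  proof -
    have cont: "continuous_on K g"
      by (rule continuous_on_sos_polys[OF g(1)])
    have "f a = (LINT x:K|lebesgue. g x * f a)"
      by (simp add: g(2))
    also have "\<dots> \<le> (LINT x:K|lebesgue. g x * f x)"
    proof (rule set_integral_mono)
      show "set_integrable lebesgue K (\<lambda>x. g x * f a)" "set_integrable lebesgue K (\<lambda>x. g x * f x)"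
        using assms cont by (auto intro!: set_integrable_lebesgue_compact continuous_intros)
      show "g x * f a \<le> g x * f x" if "x \<in> K" for x
        using a(2)[OF that] sos_polys_nonneg[OF g(1)] by (rule mult_left_mono)
    qed
    finally show ?thesis .
  qed
  then show "bdd_below {LINT x:K|lebesgue. h x * f x |h. h \<in> sos_polys r \<and> (LINT x:K|lebesgue. h x) = 1}"
    unfolding bdd_below_def by blast
qed (use h in blast)

lemma lasserre_upper_le_first_moment:
  assumes K: "compact K" "a \<in> K" and lip: "M-lipschitz_on K f"
    and h: "h \<in> sos_polys r" "(LINT x:K|lebesgue. h x) = 1"
  shows "lasserre_upper K f r - f a \<le> M * (LINT x:K|lebesgue. h x * norm (x - a))"
proof -
  have cont: "continuous_on K h" "continuous_on K f"
    using continuous_on_sos_polys[OF h(1)] lipschitz_on_continuous_on[OF lip] by auto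
  have int: "set_integrable lebesgue K (\<lambda>x. h x * f x)" "set_integrable lebesgue K (\<lambda>x. h x * f a)"
    "set_integrable lebesgue K (\<lambda>x. M * (h x * norm (x - a)))"
    using K cont by (auto intro!: set_integrable_lebesgue_compact continuous_intros)
  have "lasserre_upper K f r \<le> (LINT x:K|lebesgue. h x * f x)"
    using K cont h by (intro lasserre_upper_le) auto
  also have "\<dots> \<le> (LINT x:K|lebesgue. h x * f a + M * (h x * norm (x - a)))"
  proof (rule set_integral_mono)
    fix x assume "x \<in> K"
    then have "f x \<le> f a + M * norm (x - a)"
      using lipschitz_onD[OF lip, of x a] K by (simp add: dist_norm)
    then have "h x * f x \<le> h x * (f a + M * norm (x - a))"
      by (rule mult_left_mono[OF _ sos_polys_nonneg[OF h(1)]])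
    then show "h x * f x \<le> h x * f a + M * (h x * norm (x - a))"
      by (simp add: algebra_simps)
  qed (use int in auto)
  also have "\<dots> = f a + M * (LINT x:K|lebesgue. h x * norm (x - a))"
    using int h by (simp add: set_integral_add)
  finally show ?thesis
    by simp
qed

section \<open>Polynomials that peak at a point\<close>

definition peak :: "real \<Rightarrow> real ^ 'n::finite \<Rightarrow> nat \<Rightarrow> real ^ 'n \<Rightarrow> real" where
  "peak D a N x = (1 - (norm (x - a))\<^sup>2 / D) ^ N"

lemma peak_in_polys_deg_le: "peak D a N \<in> polys_deg_le (2 * N)"
proof -
  have shift: "(\<lambda>x. x $ i + (- (a $ i))) \<in> polys_deg_le 1" for i
    by (intro polys_deg_le_add coordinate_in_polys_deg_le polys_deg_le_const)
  have "(\<lambda>x. (x $ i + (- (a $ i))) ^ 2) \<in> polys_deg_le 2" for i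
    using polys_deg_le_power[OF shift[of i], of 2] by simp
  then have "(\<lambda>x. 1 + (- 1 / D) * (\<Sum>i\<in>UNIV. (x $ i + (- (a $ i))) ^ 2)) \<in> polys_deg_le 2"
    by (intro polys_deg_le_add polys_deg_le_const polys_deg_le_scale polys_deg_le_sum)
  then have "(\<lambda>x. (1 + (- 1 / D) * (\<Sum>i\<in>UNIV. (x $ i + (- (a $ i))) ^ 2)) ^ N) \<in> polys_deg_le (N * 2)"
    by (rule polys_deg_le_power)
  moreover have "(norm (x - a))\<^sup>2 = (\<Sum>i\<in>UNIV. (x $ i + (- (a $ i))) ^ 2)" for x
    unfolding power2_norm_eq_inner inner_vec_def by (simp add: power2_eq_square)
  ultimately show ?thesis
    by (simp add: peak_def[abs_def] mult.commute)
qed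

lemma scaled_peak_in_sos_polys:
  fixes a :: "real ^ 'n::finite"
  assumes "c \<ge> 0" "2 * m \<le> r"
  shows "(\<lambda>x. c * peak D a (2 * m) x) \<in> sos_polys r"
proof -
  have "(\<lambda>x. c * peak D a (2 * m) x) \<in> polys_deg_le (2 * r)"
    using assms by (intro polys_deg_le_scale polys_deg_le_mono[OF peak_in_polys_deg_le]) simp
  moreover have "(\<lambda>x. c * peak D a (2 * m) x) = (\<lambda>x. \<Sum>j<1::nat. (sqrt c * peak D a m x)\<^sup>2)"
    using assms by (simp add: peak_def power_mult_distrib mult.commute[of 2] flip: power_mult)
  moreover have "real_polynomial_function (\<lambda>x. sqrt c * peak D a m x)"
    by (rule real_polynomial_function_polys_deg_le[OF polys_deg_le_scale[OF peak_in_polys_deg_le]])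
  ultimately show ?thesis
    unfolding sos_polys_def
    by (intro CollectI conjI exI[of _ "1 :: nat"] exI[of _ "\<lambda>_ x. sqrt c * peak D a m x"]) simp_all
qed

lemma measure_lebesgue_cball:
  fixes a :: "real ^ 'n::finite"
  assumes "s \<ge> 0"
  shows "measure lebesgue (cball a s) = unit_ball_vol (real CARD('n)) * s ^ CARD('n)"
  using content_cball[OF assms, of a] by (simp add: measure_completion)

text \<open>The part of a Gaussian of width \<open>R\<close> in the \<open>k\<close>-th shell has height at most \<open>exp (- k\<^sup>2)\<close>, distance at most
  \<open>R * (k + 1)\<close> from the centre, and a support of at most \<open>(k + 1) ^ n\<close> times the volume of a ball of
  radius \<open>R\<close>.\<close>

definition shell_const :: "nat \<Rightarrow> real" where
  "shell_const n = (\<Sum>k. real (k + 1) ^ (n + 1) * exp (- (real k)\<^sup>2))"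

lemma power_le_fact_exp:
  fixes y :: real
  assumes "0 \<le> y"
  shows "y ^ m \<le> fact m * exp y"
proof -
  have "(\<Sum>k\<in>{m}. y ^ k /\<^sub>R fact k) \<le> exp y"
    unfolding exp_def using assms by (intro sum_le_suminf summable_exp_generic) auto
  then show ?thesis
    by (simp add: field_simps)
qed

lemma summable_shell_const: "summable (\<lambda>k. real (k + 1) ^ (n + 1) * exp (- (real k)\<^sup>2))"
proof (rule summable_comparison_test')
  let ?C = "2 ^ (n + 1) * fact (n + 1) * exp (1 / 2) :: real"
  show "summable (\<lambda>k. ?C * exp (- 1 / 2) ^ k)"
    by (intro summable_mult summable_geometric) simp
  fix k :: nat
  have "real (k + 1) ^ (n + 1) = 2 ^ (n + 1) * (real (k + 1) / 2) ^ (n + 1)"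
    by (simp add: power_divide del: power_Suc)
  also have "\<dots> \<le> 2 ^ (n + 1) * (fact (n + 1) * exp (real (k + 1) / 2))"
    by (intro mult_left_mono power_le_fact_exp) auto
  finally have "real (k + 1) ^ (n + 1) \<le> 2 ^ (n + 1) * fact (n + 1) * exp (real (k + 1) / 2)"
    by (simp only: mult.assoc)
  moreover have "real k \<le> (real k)\<^sup>2"
    by (cases k) (auto intro: self_le_power)
  ultimately have "real (k + 1) ^ (n + 1) * exp (- (real k)\<^sup>2)
      \<le> (2 ^ (n + 1) * fact (n + 1) * exp (real (k + 1) / 2)) * exp (- real k)"
    by (intro mult_mono) auto
  also have "exp (real (k + 1) / 2) = exp (1 / 2) * exp (real k / 2)"
    by (simp add: add_divide_distrib flip: exp_add)
  also have "(2 ^ (n + 1) * fact (n + 1) * (exp (1 / 2) * exp (real k / 2))) * exp (- real k)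
      = ?C * (exp (real k / 2) * exp (- real k))"
    by (simp only: mult_ac)
  also have "exp (real k / 2) * exp (- real k) = exp (- 1 / 2) ^ k"
    by (simp flip: exp_add exp_of_nat_mult)
  finally show "norm (real (k + 1) ^ (n + 1) * exp (- (real k)\<^sup>2)) \<le> ?C * exp (- 1 / 2) ^ k"
    by simp
qed

lemma shell_const_nonneg: "0 \<le> shell_const n"
  unfolding shell_const_def by (intro suminf_nonneg summable_shell_const) simp

text \<open>A discrete Gaussian estimate: \<open>1 - s \<le> exp (- s)\<close> turns the \<open>N\<close>-th power into \<open>exp (- t\<^sup>2)\<close> with
  \<open>t = norm (x - a) / R\<close>, and \<open>t\<close> is rounded down to the index of its shell.  Within
  distance \<open>sqrt D\<close> of \<open>a\<close> one has \<open>t\<^sup>2 \<le> N\<close>, so finitely many shells suffice and no integral over an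
  unbounded region occurs.\<close>

lemma peak_le_shells:
  fixes a x :: "real ^ 'n::finite"
  assumes D: "D > 0" and N: "N > 0" and x: "(norm (x - a))\<^sup>2 \<le> D"
  defines "R \<equiv> sqrt (D / N)"
  shows "peak D a N x * norm (x - a)
    \<le> (\<Sum>k\<le>N. (exp (- (real k)\<^sup>2) * (R * real (k + 1))) * indicator (cball a (R * real (k + 1))) x)"
proof -
  have R: "R > 0" "R\<^sup>2 = D / N"
    using D N by (auto simp: R_def)
  \<comment> \<open>\<open>x\<close> lies in the shell with index \<open>j\<close>, and the \<open>j\<close>-th summand alone is large enough.\<close>
  define t where "t = norm (x - a) / R"
  define j where "j = nat \<lfloor>t\<rfloor>"
  have t: "0 \<le> t" "t\<^sup>2 = N * ((norm (x - a))\<^sup>2 / D)"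
    using R D N by (auto simp: t_def power_divide)
  have norm_eq: "norm (x - a) = R * t"
    using R by (simp add: t_def)
  have j: "real j \<le> t" "t \<le> real (j + 1)"
    using t unfolding j_def by linarith+
  have "t\<^sup>2 \<le> real N * 1"
    unfolding t(2) using x D by (intro mult_left_mono) auto
  then have "t\<^sup>2 \<le> (real N)\<^sup>2"
    using N by (intro order_trans[OF _ self_le_power]) auto
  then have "t \<le> real N"
    by (rule power2_le_imp_le) simp
  then have "j \<le> N"
    using j(1) by linarith
  have in_ball: "x \<in> cball a (R * real (j + 1))"
    using R mult_left_mono[OF j(2), of R] by (simp add: norm_minus_commute[of a x] dist_norm norm_eq)
  have "peak D a N x \<le> exp (- ((norm (x - a))\<^sup>2 / D)) ^ N"
    unfolding peak_def using x D exp_ge_add_one_self[of "- ((norm (x - a))\<^sup>2 / D)"]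
    by (intro power_mono) auto
  also have "\<dots> = exp (- t\<^sup>2)"
    unfolding t(2) by (simp flip: exp_of_nat_mult)
  also have "\<dots> \<le> exp (- (real j)\<^sup>2)"
    using power_mono[OF j(1), of 2] by simp
  finally have "peak D a N x * norm (x - a) \<le> exp (- (real j)\<^sup>2) * (R * real (j + 1))"
    using j R t(1) unfolding norm_eq by (intro mult_mono) auto
  also have "\<dots> = (exp (- (real j)\<^sup>2) * (R * real (j + 1))) * indicator (cball a (R * real (j + 1))) x"
    using in_ball by simp
  also have "\<dots> \<le> (\<Sum>k\<le>N. (exp (- (real k)\<^sup>2) * (R * real (k + 1))) * indicator (cball a (R * real (k + 1))) x)"
    using R \<open>j \<le> N\<close> by (intro member_le_sum) auto
  finally show ?thesis .
qed

lemma peak_first_moment_le: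
  fixes a :: "real ^ 'n::finite"
  assumes K: "compact K" and D: "D > 0" and N: "N > 0"
    and diam: "\<And>x. x \<in> K \<Longrightarrow> (norm (x - a))\<^sup>2 \<le> D"
  defines "R \<equiv> sqrt (D / N)"
  shows "(LINT x:K|lebesgue. peak D a N x * norm (x - a))
    \<le> shell_const CARD('n) * R * measure lebesgue (cball a R)"
proof -
  let ?n = "CARD('n)"
  let ?\<omega> = "unit_ball_vol (real ?n)"
  have R: "R > 0"
    using D N by (simp add: R_def)
  note vol = measure_lebesgue_cball[of _ a]
  let ?g = "\<lambda>k. exp (- (real k)\<^sup>2) * (R * real (k + 1))"
  have int_peak: "set_integrable lebesgue K (\<lambda>x. peak D a N x * norm (x - a))"
    using K unfolding peak_def divide_inverse
    by (intro set_integrable_lebesgue_compact continuous_intros)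
  have int_shell: "integrable lebesgue (\<lambda>x. ?g k * indicator (cball a (R * real (k + 1))) x)" for k
    using lmeasurable_cball[of a "R * real (k + 1)"]
    by (intro integrable_mult_right integrable_real_indicator) (auto simp: fmeasurable_def)
  have "(LINT x:K|lebesgue. peak D a N x * norm (x - a))
      \<le> (LINT x|lebesgue. (\<Sum>k\<le>N. ?g k * indicator (cball a (R * real (k + 1))) x))"
    unfolding set_lebesgue_integral_def
  proof (rule integral_mono)
    fix x
    show "indicator K x *\<^sub>R (peak D a N x * norm (x - a))
        \<le> (\<Sum>k\<le>N. ?g k * indicator (cball a (R * real (k + 1))) x)"
      using peak_le_shells[OF D N, of x a] diam[of x] R
      by (cases "x \<in> K") (auto simp flip: R_def intro!: sum_nonneg)
  next
    show "integrable lebesgue (\<lambda>x. indicator K x *\<^sub>R (peak D a N x * norm (x - a)))"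
      using int_peak by (simp only: set_integrable_def)
    show "integrable lebesgue (\<lambda>x. \<Sum>k\<le>N. ?g k * indicator (cball a (R * real (k + 1))) x)"
      by (intro Bochner_Integration.integrable_sum int_shell)
  qed
  also have "\<dots> = (\<Sum>k\<le>N. ?g k * measure lebesgue (cball a (R * real (k + 1))))"
    by (subst Bochner_Integration.integral_sum[OF int_shell]) simp
  also have "\<dots> = (\<Sum>k\<le>N. real (k + 1) ^ (?n + 1) * exp (- (real k)\<^sup>2)) * (R * (?\<omega> * R ^ ?n))"
    unfolding sum_distrib_right
  proof (rule sum.cong)
    fix k
    have "measure lebesgue (cball a (R * real (k + 1))) = ?\<omega> * (R ^ ?n * real (k + 1) ^ ?n)"
      using R vol[of "R * real (k + 1)"] by (simp only: power_mult_distrib) simp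
    then show "?g k * measure lebesgue (cball a (R * real (k + 1)))
        = real (k + 1) ^ (?n + 1) * exp (- (real k)\<^sup>2) * (R * (?\<omega> * R ^ ?n))"
      by (simp only: power_add power_one_right mult_ac)
  qed simp
  also have "\<dots> \<le> shell_const ?n * (R * (?\<omega> * R ^ ?n))"
    using R unfolding shell_const_def
    by (intro mult_right_mono sum_le_suminf summable_shell_const) auto
  also have "\<dots> = shell_const ?n * R * measure lebesgue (cball a R)"
    using R by (simp only: vol[OF less_imp_le] mult_ac)
  finally show ?thesis .
qed

text \<open>On the ball of radius \<open>\<kappa> * sqrt (D / N)\<close> the base of the power is at least \<open>1 - \<kappa>\<^sup>2 / N\<close>, and Bernoulli's
  inequality keeps its \<open>N\<close>-th power at or above \<open>1 - \<kappa>\<^sup>2\<close>, which does not depend on \<open>N\<close>.\<close>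

lemma peak_mass_ge:
  fixes a :: "real ^ 'n::finite"
  assumes K: "compact K" and D: "D > 0" and N: "N > 0"
    and diam: "\<And>x. x \<in> K \<Longrightarrow> (norm (x - a))\<^sup>2 \<le> D"
    and \<kappa>: "0 \<le> \<kappa>" "\<kappa>\<^sup>2 \<le> 1 / 2"
  shows "measure lebesgue (cball a (\<kappa> * sqrt (D / N)) \<inter> K) / 2 \<le> (LINT x:K|lebesgue. peak D a N x)"
proof -
  define B where "B = cball a (\<kappa> * sqrt (D / N)) \<inter> K"
  have B: "B \<in> lmeasurable"
    unfolding B_def using K by (intro lmeasurable_compact compact_Int) auto
  have int_peak: "set_integrable lebesgue K (peak D a N)"
    using K unfolding peak_def[abs_def] divide_inverse
    by (intro set_integrable_lebesgue_compact continuous_intros)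
  have int_B: "integrable lebesgue (\<lambda>x. 1 / 2 * indicator B x :: real)"
    using B by (intro integrable_mult_right integrable_real_indicator) (auto simp: fmeasurable_def)
  have in_B: "1 / 2 \<le> peak D a N x" if "x \<in> B" for x
  proof -
    have "norm (x - a) \<le> \<kappa> * sqrt (D / N)"
      using that by (simp add: B_def dist_norm norm_minus_commute)
    then have "(norm (x - a))\<^sup>2 \<le> \<kappa>\<^sup>2 * (D / N)"
      using power_mono[of "norm (x - a)" _ 2] D by (fastforce simp: power_mult_distrib)
    then have base: "1 - \<kappa>\<^sup>2 / N \<le> 1 - (norm (x - a))\<^sup>2 / D"
      using D N by (simp add: field_simps)
    have "\<kappa>\<^sup>2 / N \<le> \<kappa>\<^sup>2 / 1"
      using N by (intro divide_left_mono) auto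
    also have "\<dots> \<le> 1 / 2"
      using \<kappa> by simp
    finally have small: "\<kappa>\<^sup>2 / N \<le> 1 / 2" .
    have "1 / 2 \<le> (1 - \<kappa>\<^sup>2 / N) ^ N"
    proof -
      have "1 + real N * (- (\<kappa>\<^sup>2 / N)) \<le> (1 + - (\<kappa>\<^sup>2 / N)) ^ N"
        using small by (intro Bernoulli_inequality) linarith
      then show ?thesis
        using \<kappa> N by simp
    qed
    also have "\<dots> \<le> peak D a N x"
      unfolding peak_def
    proof (rule power_mono[OF base])
      show "0 \<le> 1 - \<kappa>\<^sup>2 / N"
        using small by linarith
    qed
    finally show ?thesis .
  qed
  have "measure lebesgue B / 2 = (LINT x|lebesgue. 1 / 2 * indicator B x)"
    using B by simp
  also have "\<dots> \<le> (LINT x:K|lebesgue. peak D a N x)"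
    unfolding set_lebesgue_integral_def
  proof (rule integral_mono[OF int_B])
    show "integrable lebesgue (\<lambda>x. indicator K x *\<^sub>R peak D a N x)"
      using int_peak by (simp add: set_integrable_def)
    fix x
    have "x \<in> K \<Longrightarrow> 0 \<le> peak D a N x"
      unfolding peak_def using diam[of x] D by simp
    then show "1 / 2 * indicator B x \<le> indicator K x *\<^sub>R peak D a N x"
      using in_B[of x] by (auto simp: indicator_def B_def)
  qed
  finally show ?thesis
    by (simp add: B_def)
qed

section \<open>Localising sums of squares under the density condition\<close>

text \<open>A single point has measure 0, whereas the density condition forces positive measure.\<close>

lemma diameter_pos_if_density_cond:
  fixes K :: "(real ^ 'n::finite) set"
  assumes K: "compact K" "a \<in> K" and dens: "density_cond K a \<eta> \<epsilon>"
  shows "0 < diameter K"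
proof (rule ccontr)
  assume "\<not> 0 < diameter K"
  then have "x = a" if "x \<in> K" for x
    using diameter_bounded_bound[OF compact_imp_bounded[OF K(1)] that K(2)]
    by (meson dist_le_zero_iff order_trans not_less)
  then have "cball a \<epsilon> \<inter> K \<subseteq> {a}"
    by auto
  then have "measure lebesgue (cball a \<epsilon> \<inter> K) = 0"
    by (meson negligible_iff_measure negligible_sing negligible_subset)
  moreover have "0 < \<eta> * measure lebesgue (cball a \<epsilon>)"
    using dens by (simp add: density_cond_def measure_lebesgue_cball)
  moreover have "\<eta> * measure lebesgue (cball a \<epsilon>) \<le> measure lebesgue (cball a \<epsilon> \<inter> K)"
    using dens by (simp add: density_cond_def)
  ultimately show False
    by linarith
qed

text \<open>Both branches of \<open>r_bound\<close> give the same lower bound once \<open>\<epsilon>\<close> is replaced by \<open>min \<epsilon> 1\<close>; the slack in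
  \<open>exp 1 \<ge> 2\<close> removes the constants.\<close>

lemma r_bound_ge:
  fixes K :: "(real ^ 'n::finite) set"
  assumes "\<epsilon> > 0"
  shows "(diameter K)\<^sup>2 / (min \<epsilon> 1) ^ 3 \<le> r_bound K \<epsilon>"
proof -
  have "(2::real) \<le> exp 1"
    using exp_ge_add_one_self[of 1] by simp
  then have "(diameter K)\<^sup>2 * 2 \<le> (diameter K)\<^sup>2 * exp 1"
    by (rule mult_left_mono) simp
  then have D: "(diameter K)\<^sup>2 \<le> sq_diameter K * exp 1 / 2"
    by (simp add: sq_diameter_def)
  show ?thesis
  proof (cases "\<epsilon> \<le> 1")
    case True
    have "(diameter K)\<^sup>2 / \<epsilon> ^ 3 \<le> (sq_diameter K * exp 1 / 2) / \<epsilon> ^ 3"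
      using D assms by (intro divide_right_mono) auto
    with True show ?thesis
      by (simp add: r_bound_def min_def)
  next
    case False
    with D show ?thesis
      by (simp add: r_bound_def min_def)
  qed
qed

text \<open>The factor by which the radius \<open>\<delta> / sqrt N\<close> is shrunk before the density condition is applied.  The first
  bound keeps the peak at or above 1/2 on the smaller ball, the second makes \<open>ball_radius_le\<close> applicable.\<close>

definition ball_ratio :: "(real ^ 'n::finite) set \<Rightarrow> real" where
  "ball_ratio K = min (1 / 2) (1 / diameter K)"

definition localization_const :: "(real ^ 'n::finite) set \<Rightarrow> real \<Rightarrow> real" where
  "localization_const K \<eta> =
     2 * sqrt 2 * shell_const CARD('n) * diameter K / (\<eta> * ball_ratio K ^ CARD('n))"

lemma localization_const_nonneg:
  fixes K :: "(real ^ 'n::finite) set"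
  assumes "compact K" "\<eta> \<ge> 0"
  shows "0 \<le> localization_const K \<eta>"
  using assms diameter_ge_0[OF compact_imp_bounded[OF assms(1)]] shell_const_nonneg[of "CARD('n)"]
  by (simp add: localization_const_def ball_ratio_def)

text \<open>The assumption on \<open>N\<close> bounds \<open>\<epsilon> ^ 3\<close> from below by a multiple of \<open>1 / N\<close>.  The cube of the radius is of
  order \<open>N ^ (- 3 / 2)\<close>, so there is room to spare: one of its three factors is simply bounded by 1, using
  \<open>\<kappa> * \<delta> \<le> 1\<close>.\<close>

lemma ball_radius_le:
  fixes \<delta> \<epsilon> :: real
  assumes \<delta>: "\<delta> > 0" and N: "N \<ge> 1" and \<kappa>: "0 \<le> \<kappa>" "\<kappa> \<le> 1" "\<kappa> * \<delta> \<le> 1"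
    and \<epsilon>: "\<epsilon> > 0" "\<delta>\<^sup>2 / \<epsilon> ^ 3 \<le> N"
  shows "\<kappa> * sqrt (\<delta>\<^sup>2 / N) \<le> \<epsilon>"
proof -
  define s where "s = sqrt (\<delta>\<^sup>2 / N)"
  have s: "0 \<le> s" "s\<^sup>2 = \<delta>\<^sup>2 / N"
    using N by (auto simp: s_def)
  have "s\<^sup>2 \<le> \<delta>\<^sup>2"
    using N divide_left_mono[of 1 N "\<delta>\<^sup>2"] unfolding s(2) by simp
  then have "s \<le> \<delta>"
    using \<delta> power2_le_imp_le by fastforce
  then have "\<kappa> * s \<le> 1"
    using \<kappa> mult_left_mono[of s \<delta> \<kappa>] by linarith
  have "(\<kappa> * s) ^ 3 = (\<kappa> * s) * (\<kappa>\<^sup>2 * s\<^sup>2)"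
    by (simp add: power2_eq_square power3_eq_cube)
  also have "\<dots> \<le> 1 * (1 * s\<^sup>2)"
    using \<open>\<kappa> * s \<le> 1\<close> \<kappa> s(1) by (intro mult_mono) (auto simp: power_le_one)
  also have "\<dots> \<le> \<epsilon> ^ 3"
    using \<epsilon> N unfolding s(2) by (simp add: field_simps)
  finally show ?thesis
    using \<epsilon> power_mono_iff[of "\<kappa> * s" \<epsilon> 3] \<kappa> s(1) by (simp add: s_def)
qed

text \<open>Numerator and denominator of the normalised first moment are both proportional to the volume of the ball of
  radius \<open>R\<close>, which cancels.  What remains is a multiple of \<open>R / \<eta>\<close>, and \<open>R\<close> is of order \<open>1 / sqrt r\<close>.\<close>

lemma localizing_sos:
  fixes K :: "(real ^ 'n::finite) set"
  assumes K: "compact K" "a \<in> K"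
    and dens: "density_cond K a \<eta> \<epsilon>"
    and r: "real r \<ge> r_bound K \<epsilon> + 1"
  obtains h where "h \<in> sos_polys r" "(LINT x:K|lebesgue. h x) = 1"
    "(LINT x:K|lebesgue. h x * norm (x - a)) \<le> localization_const K \<eta> / sqrt (real r)"
proof -
  let ?n = "CARD('n)"
  define \<delta> where "\<delta> = diameter K"
  define D where "D = \<delta>\<^sup>2"
  define \<kappa> where "\<kappa> = ball_ratio K"
  \<comment> \<open>The exponent must be even for the peak to be a square; rounding down costs at most a factor 2.\<close>
  define N where "N = 2 * (r div 2)"
  define R where "R = sqrt (D / N)"
  have \<eta>: "\<eta> > 0" and \<epsilon>: "\<epsilon> > 0"
    using dens by (auto simp: density_cond_def)
  have \<delta>: "\<delta> > 0" and D: "D > 0"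
    using diameter_pos_if_density_cond[OF K dens] by (auto simp: \<delta>_def D_def)
  have diam: "(norm (x - a))\<^sup>2 \<le> D" if "x \<in> K" for x
    using diameter_bounded_bound[OF compact_imp_bounded[OF K(1)] that K(2)]
    by (simp add: D_def \<delta>_def dist_norm power_mono)
  have \<kappa>: "0 < \<kappa>" "\<kappa> \<le> 1 / 2" "\<kappa> * \<delta> \<le> 1"
    using \<delta> by (auto simp: \<kappa>_def ball_ratio_def min_def field_simps simp flip: \<delta>_def)
  have r_ge: "D / (min \<epsilon> 1) ^ 3 \<le> real r - 1"
    using r_bound_ge[OF \<epsilon>, of K] r by (simp add: D_def \<delta>_def)
  moreover have "0 < D / (min \<epsilon> 1) ^ 3"
    using D \<epsilon> by simp
  ultimately have "r \<ge> 2"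
    by linarith
  then have N: "N > 0" "real r - 1 \<le> real N" "real r / 2 \<le> real N"
    unfolding N_def by linarith+
  have R: "R > 0"
    using D N by (simp add: R_def)
  \<comment> \<open>The density condition may be used for the ball of radius \<open>\<kappa> * R\<close> only once this is known.\<close>
  have "\<kappa> * R \<le> min \<epsilon> 1"
    unfolding R_def D_def
    by (rule ball_radius_le) (use \<delta> \<kappa> \<epsilon> N r_ge in \<open>auto simp: D_def\<close>)
  then have \<kappa>R: "\<kappa> * R \<le> \<epsilon>"
    by simp
  define V where "V = measure lebesgue (cball a R)"
  define I where "I = (LINT x:K|lebesgue. peak D a N x)"
  have V: "V > 0"
    using R by (simp add: V_def measure_lebesgue_cball)
  have "\<eta> * (\<kappa> ^ ?n * V) = \<eta> * measure lebesgue (cball a (\<kappa> * R))"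
  proof -
    have "0 \<le> \<kappa> * R" "0 \<le> R"
      using \<kappa> R by simp_all
    from this[THEN measure_lebesgue_cball, of a] show ?thesis
      by (simp only: V_def power_mult_distrib mult_ac)
  qed
  also have "\<dots> \<le> measure lebesgue (cball a (\<kappa> * R) \<inter> K)"
    using dens \<kappa> R \<kappa>R by (simp add: density_cond_def)
  also have "\<dots> \<le> 2 * I"
    using peak_mass_ge[OF K(1) D N(1) diam, of \<kappa>] \<kappa> power_mono[OF \<kappa>(2), of 2]
    by (simp add: I_def R_def power_divide)
  finally have I_ge: "\<eta> * \<kappa> ^ ?n * V / 2 \<le> I"
    by simp
  moreover have pos: "0 < \<eta> * \<kappa> ^ ?n * V / 2"
    using \<eta> \<kappa> V by simp
  ultimately have I: "I > 0"
    by linarith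
  define h where "h = (\<lambda>x. 1 / I * peak D a N x)"
  show thesis
  proof (rule that)
    show "h \<in> sos_polys r"
      unfolding h_def N_def using I by (intro scaled_peak_in_sos_polys) auto
    show "(LINT x:K|lebesgue. h x) = 1"
      using I by (simp add: h_def flip: I_def)
    have "(LINT x:K|lebesgue. h x * norm (x - a)) = (LINT x:K|lebesgue. peak D a N x * norm (x - a)) / I"
      by (simp add: h_def)
    also have "\<dots> \<le> shell_const ?n * R * V / I"
      using peak_first_moment_le[OF K(1) D N(1) diam] I
      by (intro divide_right_mono) (auto simp: R_def V_def)
    also have "\<dots> \<le> shell_const ?n * R * V / (\<eta> * \<kappa> ^ ?n * V / 2)"
      using I_ge pos I R V shell_const_nonneg by (intro divide_left_mono) auto
    also have "\<dots> = 2 * shell_const ?n * R / (\<eta> * \<kappa> ^ ?n)"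
      using V by simp
    also have "\<dots> \<le> 2 * shell_const ?n * (sqrt 2 * \<delta> / sqrt r) / (\<eta> * \<kappa> ^ ?n)"
    proof -
      have "D / N \<le> D / (real r / 2)"
        using N D \<open>r \<ge> 2\<close> by (intro divide_left_mono) auto
      then have "R \<le> sqrt (D / (real r / 2))"
        unfolding R_def by (rule real_sqrt_le_mono)
      also have "\<dots> = sqrt 2 * \<delta> / sqrt r"
        using \<delta> by (simp add: D_def real_sqrt_divide real_sqrt_mult)
      finally show ?thesis
        using \<eta> \<kappa> shell_const_nonneg by (intro divide_right_mono mult_left_mono) auto
    qed
    also have "\<dots> = localization_const K \<eta> / sqrt (real r)"
      by (simp add: localization_const_def \<kappa>_def \<delta>_def mult_ac)
    finally show "(LINT x:K|lebesgue. h x * norm (x - a)) \<le> localization_const K \<eta> / sqrt (real r)" .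
  qed
qed

section \<open>The convergence rate\<close>

lemma lasserre_upper_error:
  assumes K: "compact K" and lip: "M-lipschitz_on K f"
    and a: "is_global_minimizer K f a" and dens: "density_cond K a \<eta> \<epsilon>"
    and r: "real r \<ge> r_bound K \<epsilon> + 1"
  shows "lasserre_upper K f r - (INF x\<in>K. f x) \<le> localization_const K \<eta> * M / sqrt (real r)"
proof -
  have "a \<in> K" "\<And>x. x \<in> K \<Longrightarrow> f a \<le> f x"
    using a by (auto simp: is_global_minimizer_def)
  then have f_min: "(INF x\<in>K. f x) = f a"
    by (intro cInf_eq_minimum) auto
  obtain h where h: "h \<in> sos_polys r" "(LINT x:K|lebesgue. h x) = 1"
    "(LINT x:K|lebesgue. h x * norm (x - a)) \<le> localization_const K \<eta> / sqrt (real r)"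
    using localizing_sos[OF K \<open>a \<in> K\<close> dens r] .
  have "lasserre_upper K f r - f a \<le> M * (LINT x:K|lebesgue. h x * norm (x - a))"
    by (rule lasserre_upper_le_first_moment[OF K \<open>a \<in> K\<close> lip h(1,2)])
  also have "\<dots> \<le> M * (localization_const K \<eta> / sqrt (real r))"
    using h(3) lipschitz_on_nonneg[OF lip] by (rule mult_left_mono)
  finally show ?thesis
    by (simp add: f_min mult.commute)
qed

text \<open>The first estimate is \<open>lasserre_upper_error\<close>; the second one is its instance at the Lipschitz constant from
  \<open>convex_body_markov_const\<close>.  The factor \<open>C\<close> in \<open>\<zeta>\<close> is only there to serve both with the same function.\<close>

theorem theorem3:
  fixes K :: "(real ^ 'n) set"
  assumes "compact K"
    and "\<forall>a\<in>K. \<exists>\<eta> \<epsilon>K. density_cond K a \<eta> \<epsilon>K"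
  shows "\<exists>\<zeta> :: real \<Rightarrow> real.
    (\<forall>f M a \<eta> \<epsilon>K r.
       continuous_on UNIV f \<and> M-lipschitz_on K f \<and>
       is_global_minimizer K f a \<and> density_cond K a \<eta> \<epsilon>K \<and>
       real r \<ge> r_bound K \<epsilon>K + 1 \<longrightarrow>
       lasserre_upper K f r - (INF x\<in>K. f x) \<le> \<zeta> \<eta> * M / sqrt (real r)) \<and>
    (\<forall>f d a \<eta> \<epsilon>K r.
       convex_body K \<and> polynomial_of_degree d f \<and>
       is_global_minimizer K f a \<and> density_cond K a \<eta> \<epsilon>K \<and>
       real r \<ge> r_bound K \<epsilon>K + 1 \<longrightarrow>
       lasserre_upper K f r - (INF x\<in>K. f x)
         \<le> 2 * (real d)\<^sup>2 * \<zeta> \<eta> * (SUP x\<in>K. \<bar>f x\<bar>) / min_width K * (1 / sqrt (real r)))"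
proof -
  obtain C where C: "C \<ge> 1" "\<And>f d. convex_body K \<Longrightarrow> polynomial_of_degree d f \<Longrightarrow>
      (2 * (real d)\<^sup>2 * C * (SUP x\<in>K. \<bar>f x\<bar>) / min_width K)-lipschitz_on K f"
    using convex_body_markov_const[of K] by (metis order_refl)
  show ?thesis
  proof (intro exI[of _ "\<lambda>\<eta>. C * localization_const K \<eta>"] conjI allI impI; elim conjE)
    fix f M a \<eta> \<epsilon> r
    assume f: "M-lipschitz_on K f" "is_global_minimizer K f a"
      and dens: "density_cond K a \<eta> \<epsilon>" and r: "real r \<ge> r_bound K \<epsilon> + 1"
    have "0 \<le> localization_const K \<eta>"
      using dens assms(1) by (intro localization_const_nonneg) (auto simp: density_cond_def)
    then have "1 * localization_const K \<eta> * M / sqrt (real r) \<le> C * localization_const K \<eta> * M / sqrt (real r)"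
      using C(1) lipschitz_on_nonneg[OF f(1)] by (intro divide_right_mono mult_right_mono) auto
    then show "lasserre_upper K f r - (INF x\<in>K. f x) \<le> C * localization_const K \<eta> * M / sqrt (real r)"
      using lasserre_upper_error[OF assms(1) f dens r] by simp
  next
    fix f d a \<eta> \<epsilon> r
    assume K: "convex_body K" and f: "polynomial_of_degree d f" "is_global_minimizer K f a"
      and dens: "density_cond K a \<eta> \<epsilon>" and r: "real r \<ge> r_bound K \<epsilon> + 1"
    show "lasserre_upper K f r - (INF x\<in>K. f x)
      \<le> 2 * (real d)\<^sup>2 * (C * localization_const K \<eta>) * (SUP x\<in>K. \<bar>f x\<bar>) / min_width K * (1 / sqrt (real r))"
      using lasserre_upper_error[OF assms(1) C(2)[OF K f(1)] f(2) dens r] by (simp add: mult_ac)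
  qed
qed

end
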